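(* Consider the problem $$\min_{w\in\mathbb{R}^p,\,u\in\mathbb{R}^n} f(w)+\lambda\|u_+\|_0\quad\text{s.t.}\quad Aw+b=u,\qquad(\mathrm{O})$$ and, for a given $z^*\in\mathbb{R}^n$, the problem $$\min_{(w;u;v)\in\mathbb{R}^p\times\mathbb{R}^n\times\mathbb{R}^p}\mathcal{V}_{\rho,\mu}(w,u,z^*,v).\qquad(\mathrm{E}^* )$$ The following assertions hold. (i) Given a P-stationary point $(w^*;u^* )$ of (O) with constant $\alpha>0$ and P-stationary multiplier $z^*$, the point $(w^*;u^*;w^* )$ is a ${\rm P}^*$-stationary point of $(\mathrm{E}^* )$ with constant $\alpha$, for any $\mu>0$ and $\rho>0$. (ii) Given a local minimizer $(w^*;u^* )$ of (O), if $A_{S_0^*}$ is full row rank, where $S_0^*:=\{i\in[n]:u_i^*=0\}$, and $f$ is convex, then there exists a P-stationary multiplier $z^*$ of (O) such that $(w^*;u^*;w^* )$ is a local minimizer of $(\mathrm{E}^* )$ for any $\mu>0$ and $\rho>0$. (iii) Given a P-stationary point $(w^*;u^* )$ of (O) with constant $\alpha>(\|A\|^2+2)/\sigma_f$ and P-stationary multiplier $z^*$, if $f$ is $\sigma_f$-strongly convex and the parameters satisfy $$\mu>\frac{\sigma_f}{\alpha\sigma_f-\|A\|^2-2},\qquad \rho>\frac{\mu\sigma_f}{\mu(\alpha\sigma_f-\|A\|^2-2)-\sigma_f},$$ then $(w^*;u^*;w^* )$ is the unique global minimizer of $(\mathrm{E}^* )$.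
   Context: Setting: $f:\mathbb{R}^p\to\mathbb{R}$ is smooth (continuously differentiable), $A\in\mathbb{R}^{n\times p}$, $b\in\mathbb{R}^n$, $\lambda>0$, and $\rho,\mu>0$ are penalty parameters. $[n]=\{1,\dots,n\}$; $A_S$ is the submatrix of the rows of $A$ indexed by $S\subseteq[n]$. For $u\in\mathbb{R}^n$, $u_+:=(\max\{0,u_1\},\dots,\max\{0,u_n\})^\top$ and $\|u\|_0$ is the number of nonzero components of $u$. $(w;u)$ denotes concatenation; $\|A\|$ is the spectral norm. Lyapunov function: $\mathcal{V}_{\rho,\mu}(w,u,z,v):=f(w)+\lambda\|u_+\|_0+\langle z,Aw+b-u\rangle+\frac{\rho}{2}\|Aw+b-u\|^2+\frac{\mu}{2}\|w-v\|^2$. Proximal operator (set-valued): ${\rm Prox}_{\alpha\lambda\|(\cdot)_+\|_0}(z):=\arg\min_{u\in\mathbb{R}^n}\ \lambda\|u_+\|_0+\frac{1}{2\alpha}\|u-z\|^2$ for $\alpha>0$. $(w^*;u^* )$ is a P-stationary point of (O), with P-stationary multiplier $z^*\in\mathbb{R}^n$ and constant $\alpha>0$, if $$\nabla f(w^* )+A^\top z^*=0,\quad u^*\in{\rm Prox}_{\alpha\lambda\|(\cdot)_+\|_0}(u^*+\alpha z^* ),\quad Aw^*+b-u^*=0.$$ $(\widehat w;\widehat u;\widehat v)$ is a ${\rm P}^*$-stationary point of $(\mathrm{E}^* )$ with constant $\alpha>0$ if there is $\widehat z\in\mathbb{R}^n$ (a ${\rm P}^*$-stationary multiplier) with $$\nabla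 f(\widehat w)+\mu(\widehat w-\widehat v)+A^\top\widehat z=0,\quad \widehat u\in{\rm Prox}_{\alpha\lambda\|(\cdot)_+\|_0}(\widehat u+\alpha\widehat z),\quad \widehat z=z^*+\rho(A\widehat w+b-\widehat u),\quad \widehat v=\widehat w.$$ *)

theory Defs
  imports "HOL-Analysis.Analysis"
begin

definition gradient :: "('a::real_inner \<Rightarrow> real) \<Rightarrow> 'a \<Rightarrow> 'a"
  where "gradient f x = (THE g. GDERIV f x :> g)"

lemma gradient_eqI:
  assumes "GDERIV f x :> g"
  shows "gradient f x = g"
  unfolding gradient_def
proof (rule the_equality)
  show "GDERIV f x :> g" by (rule assms)
next
  fix g' assume "GDERIV f x :> g'"
  then have "(\<lambda>h. inner h g') = (\<lambda>h. inner h g)"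
    using assms unfolding gderiv_def by (rule has_derivative_unique)
  then have "inner h g' = inner h g" for h
    by metis
  then have "inner h (g' - g) = 0" for h
    by (simp add: inner_diff_right)
  from this[of "g' - g"] show "g' = g"
    by simp
qed

text \<open>Smoothness means continuous differentiability here.\<close>

definition smooth :: "('a::real_inner \<Rightarrow> real) \<Rightarrow> bool"
  where "smooth f \<longleftrightarrow> (\<forall>x. f differentiable (at x)) \<and> continuous_on UNIV (gradient f)"

text \<open>The modulus of strong convexity is required to be positive.\<close>

definition strongly_convex :: "real \<Rightarrow> ('a::real_inner \<Rightarrow> real) \<Rightarrow> bool"
  where "strongly_convex \<sigma> f \<longleftrightarrow> \<sigma> > 0 \<and>
    (\<forall>x y. \<forall>t\<in>{0..1}. f ((1 - t) *\<^sub>R x + t *\<^sub>R y)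
        \<le> (1 - t) * f x + t * f y - \<sigma> / 2 * t * (1 - t) * (norm (x - y))\<^sup>2)"

definition spectral_norm :: "real^'p^'n \<Rightarrow> real"
  where "spectral_norm A = onorm ((*v) A)"

text \<open>The rank of the submatrix of rows indexed by \<open>S\<close> is the dimension of the span of these
  rows, as in the library's \<open>rank\<close>. For \<open>S = {}\<close> the condition holds trivially.\<close>

definition full_row_rank_on :: "real^'p^'n \<Rightarrow> 'n set \<Rightarrow> bool"
  where "full_row_rank_on A S \<longleftrightarrow> dim {row i A | i. i \<in> S} = card S"

definition pos_part :: "real^'n \<Rightarrow> real^'n"
  where "pos_part u = (\<chi> i. max 0 (u $ i))"

definition l0_norm :: "real^'n \<Rightarrow> nat"
  where "l0_norm u = card {i. u $ i \<noteq> 0}"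

definition local_minimizer_on :: "'a::metric_space set \<Rightarrow> ('a \<Rightarrow> real) \<Rightarrow> 'a \<Rightarrow> bool"
  where "local_minimizer_on S g x \<longleftrightarrow> x \<in> S \<and> (\<exists>e>0. \<forall>y\<in>S \<inter> ball x e. g x \<le> g y)"

definition global_minimizer :: "('a \<Rightarrow> real) \<Rightarrow> 'a \<Rightarrow> bool"
  where "global_minimizer g x \<longleftrightarrow> (\<forall>y. g x \<le> g y)"

definition unique_global_minimizer :: "('a \<Rightarrow> real) \<Rightarrow> 'a \<Rightarrow> bool"
  where "unique_global_minimizer g x \<longleftrightarrow>
    global_minimizer g x \<and> (\<forall>y. global_minimizer g y \<longrightarrow> y = x)"

definition objective :: "(real^'p \<Rightarrow> real) \<Rightarrow> real \<Rightarrow> (real^'p) \<times> (real^'n) \<Rightarrow> real"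
  where "objective f lam = (\<lambda>(w, u). f w + lam * real (l0_norm (pos_part u)))"

definition feasible :: "real^'p^'n \<Rightarrow> real^'n \<Rightarrow> ((real^'p) \<times> (real^'n)) set"
  where "feasible A b = {(w, u). A *v w + b = u}"

definition lyapunov ::
  "(real^'p \<Rightarrow> real) \<Rightarrow> real^'p^'n \<Rightarrow> real^'n \<Rightarrow> real \<Rightarrow> real \<Rightarrow> real
    \<Rightarrow> real^'p \<Rightarrow> real^'n \<Rightarrow> real^'n \<Rightarrow> real^'p \<Rightarrow> real"
  where "lyapunov f A b lam \<rho> \<mu> w u z v =
    f w + lam * real (l0_norm (pos_part u)) + inner z (A *v w + b - u)
    + \<rho> / 2 * (norm (A *v w + b - u))\<^sup>2 + \<mu> / 2 * (norm (w - v))\<^sup>2"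

text \<open>The objective of the unconstrained problem in \<open>(w; u; v)\<close>, with the multiplier \<open>z\<close> fixed.\<close>

definition lyapunov_at ::
  "(real^'p \<Rightarrow> real) \<Rightarrow> real^'p^'n \<Rightarrow> real^'n \<Rightarrow> real \<Rightarrow> real \<Rightarrow> real \<Rightarrow> real^'n
    \<Rightarrow> (real^'p) \<times> (real^'n) \<times> (real^'p) \<Rightarrow> real"
  where "lyapunov_at f A b lam \<rho> \<mu> z = (\<lambda>(w, u, v). lyapunov f A b lam \<rho> \<mu> w u z v)"

definition prox_l0_pos :: "real \<Rightarrow> real \<Rightarrow> real^'n \<Rightarrow> (real^'n) set"
  where "prox_l0_pos \<alpha> lam z =
    {u. global_minimizer
          (\<lambda>u. lam * real (l0_norm (pos_part u)) + 1 / (2 * \<alpha>) * (norm (u - z))\<^sup>2) u}"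

definition P_stationary ::
  "(real^'p \<Rightarrow> real) \<Rightarrow> real^'p^'n \<Rightarrow> real^'n \<Rightarrow> real \<Rightarrow> real \<Rightarrow> real^'n
    \<Rightarrow> (real^'p) \<times> (real^'n) \<Rightarrow> bool"
  where "P_stationary f A b lam \<alpha> z = (\<lambda>(w, u).
    \<alpha> > 0 \<and>
    gradient f w + transpose A *v z = 0 \<and>
    u \<in> prox_l0_pos \<alpha> lam (u + \<alpha> *\<^sub>R z) \<and>
    A *v w + b - u = 0)"

definition Pstar_stationary ::
  "(real^'p \<Rightarrow> real) \<Rightarrow> real^'p^'n \<Rightarrow> real^'n \<Rightarrow> real \<Rightarrow> real \<Rightarrow> real \<Rightarrow> real^'n \<Rightarrow> real
    \<Rightarrow> (real^'p) \<times> (real^'n) \<times> (real^'p) \<Rightarrow> bool"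
  where "Pstar_stationary f A b lam \<rho> \<mu> zs \<alpha> = (\<lambda>(w, u, v).
    \<alpha> > 0 \<and>
    (\<exists>z. gradient f w + \<mu> *\<^sub>R (w - v) + transpose A *v z = 0 \<and>
         u \<in> prox_l0_pos \<alpha> lam (u + \<alpha> *\<^sub>R z) \<and>
         z = zs + \<rho> *\<^sub>R (A *v w + b - u) \<and>
         v = w))"

end

theory Submission
  imports Defs
begin

text \<open>
  All assertions about minimizers rest on comparing \<open>V(w', u', z, v')\<close> with \<open>V(w, u, z, w)\<close>
  at a point with \<open>A w + b = u\<close> and \<open>\<nabla>f(w) = - A\<^sup>T z\<close>. A lower bound on
  \<open>f(w') - f(w)\<close> produces the linear term \<open>- \<langle>z, A (w' - w)\<rangle>\<close>, a lower bound on
  \<open>\<lambda>\<parallel>u'\<^sub>+\<parallel>\<^sub>0 - \<lambda>\<parallel>u\<^sub>+\<parallel>\<^sub>0\<close> produces \<open>\<langle>z, u' - u\<rangle>\<close>, and the multiplier term of \<open>V\<close> cancels both.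
  What remains are the errors of the two bounds and the two penalty terms
  (\<open>lyapunov_at_lower_bound\<close>).

  Local minimality: at a local minimizer \<open>(w, u)\<close> of the constrained problem, moving \<open>w\<close> in a
  direction \<open>d\<close> with \<open>(A d)\<^sub>i \<le> 0\<close> wherever \<open>u\<^sub>i = 0\<close> creates no new positive component, so
  \<open>f\<close> cannot decrease to first order. By independence of the active rows this yields a
  multiplier \<open>z\<close> that is nonnegative on the zero set of \<open>u\<close> and vanishes off it
  (\<open>local_minimizer_multiplier\<close>). These signs say precisely that
  \<open>x \<mapsto> \<lambda>\<parallel>u\<^sub>+\<parallel>\<^sub>0 + \<langle>z, x - u\<rangle>\<close> supports \<open>\<lambda>\<parallel>x\<^sub>+\<parallel>\<^sub>0\<close> from below near \<open>u\<close>
  (\<open>l0_norm_pos_part_local_support\<close>). Together with convexity both errors are then zero near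
  the point, whatever the penalty parameters; moreover a local support becomes a global one
  after adding a large enough quadratic, which is the proximal condition for a small constant
  (\<open>prox_l0_pos_of_local_support\<close>).

  Unique global minimality: strong convexity gains \<open>\<sigma>/2 \<parallel>w' - w\<parallel>\<^sup>2\<close>, the proximal condition
  costs \<open>1/(2\<alpha>) \<parallel>u' - u\<parallel>\<^sup>2\<close>. Since \<open>u' - u\<close> is \<open>A (w' - w)\<close> minus the residual \<open>r\<close>, the cost is at
  most \<open>\<theta>/2 (\<sigma> \<parallel>w' - w\<parallel>\<^sup>2 + \<rho> \<parallel>r\<parallel>\<^sup>2)\<close> with \<open>\<theta> = (\<parallel>A\<parallel>\<^sup>2/\<sigma> + 1/\<rho>)/\<alpha>\<close>
  (\<open>weighted_square_bound\<close>), and the conditions on the parameters give \<open>\<theta> < 1\<close>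
  (\<open>penalty_parameters_bound\<close>). The remaining gap is positive definite in
  \<open>(w' - w, r, w' - v')\<close>.
\<close>

section \<open>Gradients and convexity\<close>

lemma GDERIV_gradient:
  fixes f :: "'a::euclidean_space \<Rightarrow> real"
  assumes "f differentiable (at x)"
  shows "GDERIV f x :> gradient f x"
proof -
  obtain D where D: "(f has_derivative D) (at x)"
    using assms unfolding differentiable_def by blast
  \<comment> \<open>The Riesz representative of the derivative.\<close>
  define g where "g = (\<Sum>b\<in>Basis. D b *\<^sub>R b)"
  have "D h = inner h g" for h
  proof -
    have "D h = D (\<Sum>b\<in>Basis. inner h b *\<^sub>R b)"
      by (simp add: euclidean_representation)
    also have "\<dots> = inner h g"
      using has_derivative_linear[OF D]
      by (simp add: g_def linear_sum linear_scale inner_sum_right mult.commute)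
    finally show ?thesis .
  qed
  then have "D = (\<lambda>h. inner h g)" by blast
  with D have "GDERIV f x :> g"
    by (simp add: gderiv_def)
  then show ?thesis
    by (simp add: gradient_eqI)
qed

lemma tendsto_directional_derivative:
  fixes f :: "'a::euclidean_space \<Rightarrow> real"
  assumes "f differentiable (at x)"
  shows "((\<lambda>t. (f (x + t *\<^sub>R d) - f x) / t) \<longlongrightarrow> inner (gradient f x) d) (at_right 0)"
proof -
  have f: "(f has_derivative (\<lambda>h. inner h (gradient f x))) (at (x + 0 *\<^sub>R d))"
    using GDERIV_gradient[OF assms] by (simp add: gderiv_def)
  have line: "((\<lambda>t. x + t *\<^sub>R d) has_derivative (\<lambda>t. t *\<^sub>R d)) (at (0::real))"
    by (auto intro!: derivative_eq_intros)
  have "((\<lambda>t. f (x + t *\<^sub>R d)) has_derivative (\<lambda>t. inner (t *\<^sub>R d) (gradient f x))) (at 0)"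
    by (rule has_derivative_compose[OF line f])
  moreover have "(\<lambda>t. inner (t *\<^sub>R d) (gradient f x)) = (*) (inner (gradient f x) d)"
    by (simp add: fun_eq_iff inner_commute)
  ultimately have "((\<lambda>t. f (x + t *\<^sub>R d)) has_real_derivative inner (gradient f x) d) (at 0)"
    by (simp add: has_field_derivative_def)
  then have "((\<lambda>t. (f (x + t *\<^sub>R d) - f x) / t) \<longlongrightarrow> inner (gradient f x) d) (at 0)"
    by (simp add: DERIV_def)
  then show ?thesis
    by (rule filterlim_mono) (simp_all add: at_le)
qed

text \<open>
  Subtracting \<open>f x\<close> from the (strong) convexity inequality, dividing by \<open>t\<close> and letting \<open>t\<close> tend
  to \<open>0\<close> turns the chord into the tangent. The value \<open>\<sigma> = 0\<close> covers plain convexity.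
\<close>

lemma gradient_inequality:
  fixes f :: "'a::euclidean_space \<Rightarrow> real"
  assumes diff: "f differentiable (at x)"
    and conv: "\<And>t. \<lbrakk>0 < t; t < 1\<rbrakk> \<Longrightarrow> f ((1 - t) *\<^sub>R x + t *\<^sub>R y)
        \<le> (1 - t) * f x + t * f y - \<sigma> / 2 * t * (1 - t) * (norm (x - y))\<^sup>2"
  shows "f y \<ge> f x + inner (gradient f x) (y - x) + \<sigma> / 2 * (norm (y - x))\<^sup>2"
proof -
  have "((\<lambda>t. (f (x + t *\<^sub>R (y - x)) - f x) / t + \<sigma> / 2 * (1 - t) * (norm (x - y))\<^sup>2)
      \<longlongrightarrow> inner (gradient f x) (y - x) + \<sigma> / 2 * (1 - 0) * (norm (x - y))\<^sup>2) (at_right 0)"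
    by (intro tendsto_intros tendsto_directional_derivative diff)
  moreover have "\<forall>\<^sub>F t in at_right 0.
      (f (x + t *\<^sub>R (y - x)) - f x) / t + \<sigma> / 2 * (1 - t) * (norm (x - y))\<^sup>2 \<le> f y - f x"
    using eventually_at_right_less[of 0] eventually_at_right_real[of 0 1, simplified]
  proof eventually_elim
    case (elim t)
    then have t: "0 < t" "t < 1" by auto
    have "x + t *\<^sub>R (y - x) = (1 - t) *\<^sub>R x + t *\<^sub>R y"
      by (simp add: algebra_simps)
    then have "f (x + t *\<^sub>R (y - x)) - f x
        \<le> t * (f y - f x - \<sigma> / 2 * (1 - t) * (norm (x - y))\<^sup>2)"
      using conv[OF t] by (simp add: algebra_simps)
    then have "(f (x + t *\<^sub>R (y - x)) - f x) / t \<le> f y - f x - \<sigma> / 2 * (1 - t) * (norm (x - y))\<^sup>2"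
      using t by (simp add: divide_le_eq mult.commute)
    then show ?case by simp
  qed
  ultimately have "inner (gradient f x) (y - x) + \<sigma> / 2 * (1 - 0) * (norm (x - y))\<^sup>2 \<le> f y - f x"
    by (rule tendsto_upperbound) simp
  then show ?thesis
    by (simp add: norm_minus_commute)
qed

lemma convex_gradient_inequality:
  fixes f :: "'a::euclidean_space \<Rightarrow> real"
  assumes "f differentiable (at x)" and "convex_on UNIV f"
  shows "f y \<ge> f x + inner (gradient f x) (y - x)"
  using gradient_inequality[OF assms(1), of y 0] convex_onD[OF assms(2)] by simp

section \<open>Multipliers for independent inequality constraints\<close>

text \<open>
  Farkas' lemma in the independent case, where orthogonal projection suffices. The directions
  orthogonal to all \<open>a i\<close> force \<open>g\<close> into their span. The sign of the coefficient of \<open>a j\<close> is read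
  off by testing with a direction orthogonal to all the other vectors but not to \<open>a j\<close>, which
  exists by independence. The rank condition also makes \<open>a\<close> injective on \<open>S\<close>, so that
  coefficients may be indexed by \<open>S\<close> rather than by the vectors.
\<close>

lemma nonneg_multipliers_of_independent:
  fixes a :: "'i \<Rightarrow> 'a::euclidean_space"
  assumes fin: "finite S" and rank: "dim (a ` S) = card S"
    and dir: "\<And>d. (\<And>i. i \<in> S \<Longrightarrow> inner (a i) d \<le> 0) \<Longrightarrow> inner g d \<ge> 0"
  obtains c where "\<And>i. i \<in> S \<Longrightarrow> c i \<ge> 0" and "g + (\<Sum>i\<in>S. c i *\<^sub>R a i) = 0"
proof -
  have card: "card (a ` S) = card S"
    using card_image_le[OF fin, of a] dim_le_card'[of "a ` S"] fin rank by simp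
  then have inj: "inj_on a S"
    using fin by (simp add: inj_on_iff_eq_card)
  have indep: "independent (a ` S)"
    by (rule card_le_dim_spanning[of _ "a ` S"]) (use fin rank card in \<open>auto simp: span_superset\<close>)
  obtain p q where pq: "p \<in> span (a ` S)" "\<And>v. v \<in> span (a ` S) \<Longrightarrow> orthogonal q v" "g = p + q"
    using orthogonal_subspace_decomp_exists[of "a ` S" g] by metis
  have q_orth: "inner (a i) q = 0" if "i \<in> S" for i
    using pq(2)[of "a i"] that by (simp add: span_base orthogonal_def inner_commute)
  \<comment> \<open>The component of \<open>g\<close> orthogonal to the span vanishes because its negative is an admissible
    direction.\<close>
  have "inner g (- q) \<ge> 0"
    by (rule dir) (simp add: q_orth)
  moreover have "inner p q = 0"
    using pq(1,2) by (simp add: orthogonal_def inner_commute)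
  ultimately have "inner q q \<le> 0"
    by (simp add: pq(3) inner_add_left)
  then have "q = 0"
    by (metis inner_ge_zero inner_eq_zero_iff order_antisym)
  then have "g \<in> span (a ` S)"
    using pq by simp
  then obtain r where "g = (\<Sum>v\<in>a ` S. r v *\<^sub>R v)"
    using span_finite[of "a ` S"] fin by auto
  then have g: "g = (\<Sum>i\<in>S. r (a i) *\<^sub>R a i)"
    by (simp add: sum.reindex[OF inj])
  have "- r (a j) \<ge> 0" if j: "j \<in> S" for j
  proof -
    \<comment> \<open>The test direction is \<open>- q\<close>, where \<open>q\<close> is the part of \<open>a j\<close> orthogonal to the other vectors.\<close>
    let ?T = "a ` (S - {j})"
    obtain p q where pq: "p \<in> span ?T" "\<And>v. v \<in> span ?T \<Longrightarrow> orthogonal q v" "a j = p + q"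
      using orthogonal_subspace_decomp_exists[of ?T "a j"] by metis
    have "?T = a ` S - {a j}"
      using inj j by (auto simp: inj_on_def)
    then have "a j \<notin> span ?T"
      using indep j by (auto simp: dependent_def)
    then have "q \<noteq> 0"
      using pq by auto
    then have qq: "inner q q > 0"
      by simp
    have other: "inner (a i) q = 0" if "i \<in> S" "i \<noteq> j" for i
      using pq(2)[of "a i"] that by (simp add: span_base orthogonal_def inner_commute)
    have "inner p q = 0"
      using pq(1,2) by (simp add: orthogonal_def inner_commute)
    then have self: "inner (a j) q = inner q q"
      by (simp add: pq(3) inner_add_left)
    have "inner g (- q) \<ge> 0"
    proof (rule dir)
      fix i assume "i \<in> S"
      then show "inner (a i) (- q) \<le> 0"
        using other self qq by (cases "i = j") auto
    qed
    moreover have "inner g q = r (a j) * inner q q"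
    proof -
      have "inner g q = (\<Sum>i\<in>S. r (a i) * inner (a i) q)"
        by (simp add: g inner_sum_left)
      also have "\<dots> = (\<Sum>i\<in>S. if i = j then r (a j) * inner q q else 0)"
        by (rule sum.cong) (auto simp: other self)
      finally show ?thesis
        using fin j by simp
    qed
    ultimately have "r (a j) * inner q q \<le> 0" by simp
    then show ?thesis
      using qq by (simp add: mult_le_0_iff)
  qed
  then show ?thesis
    using g by (intro that[of "\<lambda>i. - r (a i)"]) (auto simp: sum_negf)
qed

section \<open>Supports of the positive-part counting function and its proximal operator\<close>

lemma l0_norm_pos_part: "real (l0_norm (pos_part u)) = (\<Sum>i\<in>UNIV. if u $ i > 0 then 1 else 0)"
proof -
  have "{i. pos_part u $ i \<noteq> 0} = {i. u $ i > 0}"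
    by (auto simp: pos_part_def max_def)
  then show ?thesis
    by (simp add: l0_norm_def sum.If_cases)
qed

lemma eventually_component_pos:
  fixes u :: "real^'n"
  assumes "u $ i > 0"
  shows "\<forall>\<^sub>F x in nhds u. x $ i > 0"
  using assms tendsto_vec_nth[OF filterlim_ident] order_tendstoD(1) by blast

lemma eventually_component_neg:
  fixes u :: "real^'n"
  assumes "u $ i < 0"
  shows "\<forall>\<^sub>F x in nhds u. x $ i < 0"
  using assms tendsto_vec_nth[OF filterlim_ident] order_tendstoD(2) by blast

text \<open>
  The function is a sum over the components, so it suffices to look at one of them. Where
  \<open>u $ i \<noteq> 0\<close> the step function is constant nearby and the slope is zero. Where \<open>u $ i = 0\<close>, a
  nonnegative slope lies below \<open>0\<close> on the left, and on the right it stays below the jump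
  \<open>lam\<close> as long as \<open>x $ i\<close> is small.
\<close>

lemma l0_norm_pos_part_local_support:
  fixes u z :: "real^'n"
  assumes lam: "lam > 0"
    and off: "\<And>i. u $ i \<noteq> 0 \<Longrightarrow> z $ i = 0" and on: "\<And>i. u $ i = 0 \<Longrightarrow> z $ i \<ge> 0"
  shows "\<forall>\<^sub>F x in nhds u. lam * real (l0_norm (pos_part u)) + inner z (x - u)
      \<le> lam * real (l0_norm (pos_part x))"
proof -
  let ?h = "\<lambda>s::real. if s > 0 then 1 else 0 :: real"
  have "\<forall>\<^sub>F x in nhds u. \<forall>i. lam * ?h (u $ i) + z $ i * (x $ i - u $ i) \<le> lam * ?h (x $ i)"
  proof (rule eventually_all_finite)
    fix i
    consider "u $ i > 0" | "u $ i < 0" | "u $ i = 0" by linarith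
    then show "\<forall>\<^sub>F x in nhds u. lam * ?h (u $ i) + z $ i * (x $ i - u $ i) \<le> lam * ?h (x $ i)"
    proof cases
      case 1
      show ?thesis
        using eventually_component_pos[OF 1] by eventually_elim (use 1 off in auto)
    next
      case 2
      then show ?thesis
        using off[of i] lam by auto
    next
      case 3
      have "((\<lambda>x. z $ i * x $ i) \<longlongrightarrow> z $ i * u $ i) (nhds u)"
        by (intro tendsto_intros filterlim_ident)
      then have "\<forall>\<^sub>F x in nhds u. z $ i * x $ i < lam"
        using lam 3 by (simp add: order_tendstoD(2))
      then show ?thesis
        by eventually_elim (use 3 on in \<open>auto simp: mult_nonneg_nonpos\<close>)
    qed
  qed
  then show ?thesis
  proof eventually_elim
    case (elim x)
    then have "(\<Sum>i\<in>UNIV. lam * ?h (u $ i) + z $ i * (x $ i - u $ i)) \<le> (\<Sum>i\<in>UNIV. lam * ?h (x $ i))"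
      by (intro sum_mono) blast
    then show ?case
      by (simp add: l0_norm_pos_part sum.distrib sum_distrib_left inner_vec_def)
  qed
qed

text \<open>
  Expanding the square around \<open>u + \<alpha> z\<close> turns the proximal condition into a global support
  inequality with slope \<open>z\<close>, up to a quadratic error of weight \<open>1 / (2 \<alpha>)\<close>.
\<close>

lemma prox_l0_pos_iff:
  fixes u z :: "real^'n"
  assumes "\<alpha> > 0"
  shows "u \<in> prox_l0_pos \<alpha> lam (u + \<alpha> *\<^sub>R z) \<longleftrightarrow>
    (\<forall>x. lam * real (l0_norm (pos_part u)) + inner z (x - u)
       \<le> lam * real (l0_norm (pos_part x)) + 1 / (2 * \<alpha>) * (norm (x - u))\<^sup>2)"
proof -
  have expand: "1 / (2 * \<alpha>) * (norm (x - (u + \<alpha> *\<^sub>R z)))\<^sup>2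
      = 1 / (2 * \<alpha>) * (norm (x - u))\<^sup>2 - inner z (x - u) + \<alpha> / 2 * (norm z)\<^sup>2" for x
  proof -
    have "x - (u + \<alpha> *\<^sub>R z) = (x - u) - \<alpha> *\<^sub>R z" by simp
    then have "(norm (x - (u + \<alpha> *\<^sub>R z)))\<^sup>2
        = (norm (x - u))\<^sup>2 - 2 * \<alpha> * inner z (x - u) + \<alpha>\<^sup>2 * (norm z)\<^sup>2"
      by (simp only: power2_norm_eq_inner)
         (simp add: inner_diff_left inner_diff_right inner_commute power2_eq_square algebra_simps)
    then show ?thesis
      using assms by (simp add: field_simps power2_eq_square)
  qed
  show ?thesis
    unfolding prox_l0_pos_def global_minimizer_def mem_Collect_eq expand
    by (intro all_cong1) auto
qed

text \<open>
  Outside the ball on which the support is valid, a large multiple of the squared distance to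
  \<open>u\<close> dominates both the constant and the linear term, because the function itself is
  nonnegative. The weight of the quadratic determines the proximal constant.
\<close>

lemma prox_l0_pos_of_local_support:
  fixes u z :: "real^'n"
  assumes lam: "lam > 0"
    and loc: "\<forall>\<^sub>F x in nhds u. lam * real (l0_norm (pos_part u)) + inner z (x - u)
      \<le> lam * real (l0_norm (pos_part x))"
  shows "\<exists>\<alpha>>0. u \<in> prox_l0_pos \<alpha> lam (u + \<alpha> *\<^sub>R z)"
proof -
  define K where "K = lam * real (l0_norm (pos_part u))"
  have K: "K \<ge> 0"
    using lam by (simp add: K_def)
  obtain e where e: "e > 0" and
    near: "\<And>x. dist x u < e \<Longrightarrow> K + inner z (x - u) \<le> lam * real (l0_norm (pos_part x))"
    using loc unfolding eventually_nhds_metric K_def by blast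
  \<comment> \<open>Outside the ball of radius \<open>e\<close>, the first summand times the squared distance dominates the
    constant \<open>K\<close>, the second one the linear term; the last one makes \<open>M\<close> positive.\<close>
  define M where "M = K / e\<^sup>2 + norm z / e + 1"
  have M: "M > 0"
    using K e unfolding M_def by (intro add_nonneg_pos add_nonneg_nonneg) auto
  have "K + inner z (x - u) \<le> lam * real (l0_norm (pos_part x)) + M * (norm (x - u))\<^sup>2" for x
  proof (cases "dist x u < e")
    case True
    then show ?thesis
      using near[OF True] M by (smt (verit) mult_nonneg_nonneg zero_le_power2)
  next
    case False
    then have far: "e \<le> norm (x - u)"
      by (simp add: dist_norm)
    have "K / e\<^sup>2 * e\<^sup>2 \<le> K / e\<^sup>2 * (norm (x - u))\<^sup>2"
      using far e K by (intro mult_left_mono power_mono) auto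
    moreover have "inner z (x - u) \<le> norm z * norm (x - u)"
      by (rule norm_cauchy_schwarz)
    moreover have "norm z / e * (e * norm (x - u)) \<le> norm z / e * (norm (x - u) * norm (x - u))"
      using far e by (intro mult_left_mono mult_right_mono) auto
    moreover have "lam * real (l0_norm (pos_part x)) \<ge> 0"
      using lam by simp
    moreover have "(norm (x - u))\<^sup>2 \<ge> 0" by simp
    moreover have "M * (norm (x - u))\<^sup>2 = K / e\<^sup>2 * (norm (x - u))\<^sup>2
        + norm z / e * (norm (x - u) * norm (x - u)) + (norm (x - u))\<^sup>2"
      by (simp add: M_def algebra_simps power2_eq_square)
    moreover have "K / e\<^sup>2 * e\<^sup>2 = K" "norm z / e * (e * norm (x - u)) = norm z * norm (x - u)"
      using e by auto
    ultimately show ?thesis by linarith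
  qed
  moreover have "1 / (2 * (1 / (2 * M))) = M"
    using M by simp
  ultimately have "u \<in> prox_l0_pos (1 / (2 * M)) lam (u + (1 / (2 * M)) *\<^sub>R z)"
    using M by (subst prox_l0_pos_iff) (simp_all add: K_def)
  then show ?thesis
    using M by (intro exI[of _ "1 / (2 * M)"]) simp
qed

section \<open>First-order conditions at a local minimizer\<close>

text \<open>
  Along \<open>(w + t d, u + t A d)\<close>, which is feasible, no component becomes positive for small
  \<open>t > 0\<close>: negative ones stay negative, and zero ones do not increase. The counting term
  therefore does not grow, and optimality passes to \<open>f\<close> alone.
\<close>

lemma local_minimizer_first_order:
  fixes f :: "real^'p \<Rightarrow> real" and A :: "real^'p^'n"
  assumes diff: "f differentiable (at w)" and lam: "lam > 0"
    and min: "local_minimizer_on (feasible A b) (objective f lam) (w, u)"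
    and dir: "\<And>i. u $ i = 0 \<Longrightarrow> (A *v d) $ i \<le> 0"
  shows "inner (gradient f w) d \<ge> 0"
proof -
  have u: "A *v w + b = u"
    using min by (simp add: local_minimizer_on_def feasible_def)
  obtain e where e: "e > 0" and opt: "\<And>y. \<lbrakk>y \<in> feasible A b; dist (w, u) y < e\<rbrakk> \<Longrightarrow>
      objective f lam (w, u) \<le> objective f lam y"
    using min unfolding local_minimizer_on_def by auto
  let ?x = "\<lambda>t::real. u + t *\<^sub>R (A *v d)"
  have lim_x: "(?x \<longlongrightarrow> u + 0 *\<^sub>R (A *v d)) (at_right 0)"
    by (intro tendsto_intros)
  have "((\<lambda>t. (w + t *\<^sub>R d, ?x t)) \<longlongrightarrow> (w + 0 *\<^sub>R d, u + 0 *\<^sub>R (A *v d))) (at_right 0)"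
    by (intro tendsto_intros)
  then have close: "\<forall>\<^sub>F t in at_right 0. dist (w + t *\<^sub>R d, ?x t) (w, u) < e"
    using e by (auto dest: tendstoD)
  have neg: "\<forall>\<^sub>F t in at_right 0. \<forall>i. ?x t $ i > 0 \<longrightarrow> u $ i > 0"
  proof (rule eventually_all_finite)
    fix i
    show "\<forall>\<^sub>F t in at_right 0. ?x t $ i > 0 \<longrightarrow> u $ i > 0"
    proof (cases "u $ i < 0")
      case True
      have lim_u: "(?x \<longlongrightarrow> u) (at_right 0)"
        using lim_x by simp
      have "\<forall>\<^sub>F t in at_right 0. ?x t $ i < 0"
        by (rule eventually_compose_filterlim[OF eventually_component_neg[OF True] lim_u])
      then show ?thesis
        by eventually_elim auto
    next
      case False
      have "\<forall>\<^sub>F t in at_right (0::real). t > 0"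
        by (rule eventually_at_right_less)
      then show ?thesis
      proof eventually_elim
        case (elim t)
        show ?case
        proof
          assume "?x t $ i > 0"
          with False dir[of i] elim show "u $ i > 0"
            by (cases "u $ i = 0") (auto simp: zero_less_mult_iff)
        qed
      qed
    qed
  qed
  have "\<forall>\<^sub>F t in at_right 0. (f (w + t *\<^sub>R d) - f w) / t \<ge> 0"
    using close neg eventually_at_right_less[of 0]
  proof eventually_elim
    case (elim t)
    have "real (l0_norm (pos_part (?x t))) \<le> real (l0_norm (pos_part u))"
      unfolding l0_norm_pos_part using elim(2) by (intro sum_mono) simp
    then have "lam * real (l0_norm (pos_part (?x t))) \<le> lam * real (l0_norm (pos_part u))"
      using lam by simp
    moreover have "A *v (w + t *\<^sub>R d) + b = ?x t"
      by (simp add: matrix_vector_right_distrib matrix_vector_mult_scaleR u[symmetric])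
    then have "(w + t *\<^sub>R d, ?x t) \<in> feasible A b"
      by (simp add: feasible_def)
    then have "objective f lam (w, u) \<le> objective f lam (w + t *\<^sub>R d, ?x t)"
      using opt elim(1) by (simp add: dist_commute)
    ultimately have "f w \<le> f (w + t *\<^sub>R d)"
      by (simp add: objective_def)
    then show ?case
      using elim(3) by simp
  qed
  then show ?thesis
    by (rule tendsto_lowerbound[OF tendsto_directional_derivative[OF diff]]) simp
qed

lemma local_minimizer_multiplier:
  fixes f :: "real^'p \<Rightarrow> real" and A :: "real^'p^'n"
  assumes diff: "f differentiable (at w)" and lam: "lam > 0"
    and min: "local_minimizer_on (feasible A b) (objective f lam) (w, u)"
    and rank: "full_row_rank_on A {i. u $ i = 0}"
  obtains z where "gradient f w + transpose A *v z = 0"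
    and "\<And>i. u $ i \<noteq> 0 \<Longrightarrow> z $ i = 0" and "\<And>i. u $ i = 0 \<Longrightarrow> z $ i \<ge> 0"
proof -
  let ?S = "{i. u $ i = 0}"
  have "{row i A | i. i \<in> ?S} = (\<lambda>i. row i A) ` ?S" by blast
  then have dim: "dim ((\<lambda>i. row i A) ` ?S) = card ?S"
    using rank by (simp add: full_row_rank_on_def)
  have dir: "inner (gradient f w) d \<ge> 0" if "\<And>i. i \<in> ?S \<Longrightarrow> inner (row i A) d \<le> 0" for d
  proof (rule local_minimizer_first_order[OF diff lam min])
    fix i assume "u $ i = 0"
    then show "(A *v d) $ i \<le> 0"
      using that[of i] by (simp add: matrix_vector_mul_component row_def)
  qed
  obtain c where c: "\<And>i. i \<in> ?S \<Longrightarrow> c i \<ge> 0" "gradient f w + (\<Sum>i\<in>?S. c i *\<^sub>R row i A) = 0"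
    by (rule nonneg_multipliers_of_independent[OF _ dim dir]) auto
  define z :: "real^'n" where "z = (\<chi> i. if u $ i = 0 then c i else 0)"
  have "transpose A *v z = (\<Sum>i\<in>UNIV. z $ i *\<^sub>R row i A)"
    by (simp add: matrix_mult_sum scalar_mult_eq_scaleR column_transpose)
  also have "\<dots> = (\<Sum>i\<in>?S. c i *\<^sub>R row i A)"
    by (intro sum.mono_neutral_cong_right) (auto simp: z_def)
  finally show ?thesis
    using c by (intro that[of z]) (auto simp: z_def)
qed

section \<open>Growth of the Lyapunov function\<close>

text \<open>
  Stationarity makes the linear terms cancel: by \<open>\<nabla>f(w) = - A\<^sup>T z\<close> and feasibility, the term
  \<open>\<langle>z, A w' + b - u'\<rangle>\<close> equals \<open>- \<langle>\<nabla>f(w), w' - w\<rangle> - \<langle>z, u' - u\<rangle>\<close>. The quantities \<open>p\<close> and \<open>q\<close>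
  are the slack of the bounds on \<open>f\<close> and on the counting term; they are zero for local
  minimality and quadratic for global minimality.
\<close>

lemma lyapunov_at_lower_bound:
  fixes f :: "real^'p \<Rightarrow> real" and A :: "real^'p^'n"
  assumes feas: "A *v w + b - u = 0" and stat: "gradient f w + transpose A *v z = 0"
    and f: "f w' \<ge> f w + inner (gradient f w) (w' - w) + p"
    and l0: "lam * real (l0_norm (pos_part u)) + inner z (u' - u)
      \<le> lam * real (l0_norm (pos_part u')) + q"
  shows "lyapunov_at f A b lam \<rho> \<mu> z (w', u', v') \<ge> lyapunov_at f A b lam \<rho> \<mu> z (w, u, w)
      + p - q + \<rho> / 2 * (norm (A *v (w' - w) - (u' - u)))\<^sup>2 + \<mu> / 2 * (norm (w' - v'))\<^sup>2"
proof -
  have "A *v w' + b - u' = (A *v w' + b - u') - (A *v w + b - u)"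
    by (simp only: feas diff_zero)
  also have "\<dots> = A *v (w' - w) - (u' - u)"
    by (simp add: matrix_vector_mult_diff_distrib)
  finally have res: "A *v w' + b - u' = A *v (w' - w) - (u' - u)" .
  have "gradient f w = - (transpose A *v z)"
    using stat by (simp add: eq_neg_iff_add_eq_0)
  then have "inner (gradient f w) (w' - w) = - inner z (A *v (w' - w))"
    by (simp add: dot_lmul_matrix[symmetric] transpose_matrix_vector)
  moreover have "inner z (A *v w' + b - u') = inner z (A *v (w' - w)) - inner z (u' - u)"
    by (simp only: res inner_diff_right)
  ultimately show ?thesis
    using f l0 unfolding lyapunov_at_def lyapunov_def prod.case by (simp add: feas res)
qed

text \<open>Cauchy-Schwarz for the vectors \<open>(L / \<surd>\<sigma>, 1 / \<surd>\<rho>)\<close> and \<open>(\<surd>\<sigma> s, \<surd>\<rho> c)\<close>.\<close>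

lemma weighted_square_bound:
  fixes s c L \<sigma> \<rho> :: real
  assumes "\<sigma> > 0" "\<rho> > 0"
  shows "(L * s + c)\<^sup>2 \<le> (L\<^sup>2 / \<sigma> + 1 / \<rho>) * (\<sigma> * s\<^sup>2 + \<rho> * c\<^sup>2)"
proof -
  have "(L\<^sup>2 / \<sigma> + 1 / \<rho>) * (\<sigma> * s\<^sup>2 + \<rho> * c\<^sup>2) - (L * s + c)\<^sup>2
      = (L * \<rho> * c - \<sigma> * s)\<^sup>2 / (\<sigma> * \<rho>)"
    using assms by (simp add: field_simps power2_eq_square)
  also have "\<dots> \<ge> 0" using assms by simp
  finally show ?thesis by simp
qed

text \<open>
  With \<open>K = \<alpha> \<sigma> - L\<^sup>2 - 2\<close> the condition on \<open>\<rho>\<close> reads \<open>1 / \<rho> < K / \<sigma> - 1 / \<mu>\<close>, hence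
  \<open>\<sigma> / \<rho> < K < \<alpha> \<sigma> - L\<^sup>2\<close>.
\<close>

lemma penalty_parameters_bound:
  fixes \<alpha> \<sigma> \<mu> \<rho> L :: real
  assumes "\<sigma> > 0" "\<mu> > 0" "\<rho> > 0" and \<alpha>: "\<alpha> > (L\<^sup>2 + 2) / \<sigma>"
    and \<mu>: "\<mu> > \<sigma> / (\<alpha> * \<sigma> - L\<^sup>2 - 2)" and \<rho>: "\<rho> > \<mu> * \<sigma> / (\<mu> * (\<alpha> * \<sigma> - L\<^sup>2 - 2) - \<sigma>)"
  shows "L\<^sup>2 / \<sigma> + 1 / \<rho> < \<alpha>"
proof -
  define K where "K = \<alpha> * \<sigma> - L\<^sup>2 - 2"
  have K: "K > 0"
    using \<alpha> assms(1) by (simp add: K_def field_simps)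
  then have pos: "\<mu> * K - \<sigma> > 0"
    using \<mu>[folded K_def] by (simp add: field_simps)
  then have "\<mu> * \<sigma> < \<rho> * (\<mu> * K - \<sigma>)"
    using \<rho>[folded K_def] by (simp add: pos_divide_less_eq)
  also have "\<dots> < \<mu> * (\<rho> * K)"
    using assms by (simp add: algebra_simps)
  finally have "\<sigma> < \<rho> * K"
    using assms by simp
  then have "\<sigma> / \<rho> < K"
    using assms by (simp add: field_simps)
  then have "L\<^sup>2 + \<sigma> / \<rho> < \<alpha> * \<sigma>"
    by (simp add: K_def)
  then show ?thesis
    using assms by (simp add: field_simps)
qed

section \<open>Stationary points and minimizers of the two problems\<close>

theorem theorem2:
  fixes f :: "real^'p \<Rightarrow> real" and A :: "real^'p^'n" and b :: "real^'n" and lam :: real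
  assumes "smooth f" and "lam > 0"
  shows
    "(\<forall>w u z \<alpha>. P_stationary f A b lam \<alpha> z (w, u) \<longrightarrow>
        (\<forall>\<mu>>0. \<forall>\<rho>>0. Pstar_stationary f A b lam \<rho> \<mu> z \<alpha> (w, u, w)))
   \<and> (\<forall>w u. local_minimizer_on (feasible A b) (objective f lam) (w, u) \<and>
        full_row_rank_on A {i. u $ i = 0} \<and> convex_on UNIV f \<longrightarrow>
        (\<exists>z. (\<exists>\<alpha>. P_stationary f A b lam \<alpha> z (w, u)) \<and>
             (\<forall>\<mu>>0. \<forall>\<rho>>0.
                local_minimizer_on UNIV (lyapunov_at f A b lam \<rho> \<mu> z) (w, u, w))))
   \<and> (\<forall>w u z \<alpha> \<sigma> \<mu> \<rho>.
        P_stationary f A b lam \<alpha> z (w, u) \<and>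
        strongly_convex \<sigma> f \<and>
        \<alpha> > ((spectral_norm A)\<^sup>2 + 2) / \<sigma> \<and>
        \<mu> > 0 \<and> \<rho> > 0 \<and>
        \<mu> > \<sigma> / (\<alpha> * \<sigma> - (spectral_norm A)\<^sup>2 - 2) \<and>
        \<rho> > \<mu> * \<sigma> / (\<mu> * (\<alpha> * \<sigma> - (spectral_norm A)\<^sup>2 - 2) - \<sigma>) \<longrightarrow>
        unique_global_minimizer (lyapunov_at f A b lam \<rho> \<mu> z) (w, u, w))"
proof -
  have diff: "f differentiable (at x)" for x
    using assms(1) by (simp add: smooth_def)
  have i: "Pstar_stationary f A b lam \<rho> \<mu> z \<alpha> (w, u, w)"
    if "P_stationary f A b lam \<alpha> z (w, u)" for w u z \<alpha> \<mu> \<rho>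
    using that by (auto simp: P_stationary_def Pstar_stationary_def)
  have ii: "\<exists>z. (\<exists>\<alpha>. P_stationary f A b lam \<alpha> z (w, u)) \<and>
      (\<forall>\<mu>>0. \<forall>\<rho>>0. local_minimizer_on UNIV (lyapunov_at f A b lam \<rho> \<mu> z) (w, u, w))"
    if min: "local_minimizer_on (feasible A b) (objective f lam) (w, u)"
      and rank: "full_row_rank_on A {i. u $ i = 0}" and conv: "convex_on UNIV f" for w u
  proof -
    have feas: "A *v w + b - u = 0"
      using min by (simp add: local_minimizer_on_def feasible_def)
    obtain z where stat: "gradient f w + transpose A *v z = 0"
      and z: "\<And>i. u $ i \<noteq> 0 \<Longrightarrow> z $ i = 0" "\<And>i. u $ i = 0 \<Longrightarrow> z $ i \<ge> 0"
      using local_minimizer_multiplier[OF diff assms(2) min rank] by blast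
    note support = l0_norm_pos_part_local_support[OF assms(2) z]
    obtain \<alpha> where "\<alpha> > 0" "u \<in> prox_l0_pos \<alpha> lam (u + \<alpha> *\<^sub>R z)"
      using prox_l0_pos_of_local_support[OF assms(2) support] by blast
    then have "P_stationary f A b lam \<alpha> z (w, u)"
      using feas stat by (simp add: P_stationary_def)
    moreover have "local_minimizer_on UNIV (lyapunov_at f A b lam \<rho> \<mu> z) (w, u, w)"
      if "\<mu> > 0" "\<rho> > 0" for \<mu> \<rho>
    proof -
      obtain e where e: "e > 0" and near: "\<And>x. dist x u < e \<Longrightarrow>
          lam * real (l0_norm (pos_part u)) + inner z (x - u) \<le> lam * real (l0_norm (pos_part x))"
        using support unfolding eventually_nhds_metric by blast
      have "lyapunov_at f A b lam \<rho> \<mu> z (w, u, w) \<le> lyapunov_at f A b lam \<rho> \<mu> z (w', u', v')"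
        if "dist (w, u, w) (w', u', v') < e" for w' u' v'
      proof -
        have "dist u u' \<le> dist (w, u, w) (w', u', v')"
          using dist_snd_le[of "(w, u, w)" "(w', u', v')"] dist_fst_le[of "(u, w)" "(u', v')"] by simp
        then have "dist u' u < e"
          using that by (simp add: dist_commute)
        then have "lyapunov_at f A b lam \<rho> \<mu> z (w', u', v') \<ge> lyapunov_at f A b lam \<rho> \<mu> z (w, u, w)
            + 0 - 0 + \<rho> / 2 * (norm (A *v (w' - w) - (u' - u)))\<^sup>2 + \<mu> / 2 * (norm (w' - v'))\<^sup>2"
          by (intro lyapunov_at_lower_bound[OF feas stat])
             (use near convex_gradient_inequality[OF diff conv] in simp_all)
        moreover have "\<rho> / 2 * (norm (A *v (w' - w) - (u' - u)))\<^sup>2 \<ge> 0"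
            "\<mu> / 2 * (norm (w' - v'))\<^sup>2 \<ge> 0"
          using \<open>\<mu> > 0\<close> \<open>\<rho> > 0\<close> by simp_all
        ultimately show ?thesis by linarith
      qed
      then show ?thesis
        using e unfolding local_minimizer_on_def by auto
    qed
    ultimately show ?thesis by blast
  qed
  have iii: "unique_global_minimizer (lyapunov_at f A b lam \<rho> \<mu> z) (w, u, w)"
    if P: "P_stationary f A b lam \<alpha> z (w, u)" and sc: "strongly_convex \<sigma> f"
      and par: "\<alpha> > ((spectral_norm A)\<^sup>2 + 2) / \<sigma>" "\<mu> > 0" "\<rho> > 0"
        "\<mu> > \<sigma> / (\<alpha> * \<sigma> - (spectral_norm A)\<^sup>2 - 2)"
        "\<rho> > \<mu> * \<sigma> / (\<mu> * (\<alpha> * \<sigma> - (spectral_norm A)\<^sup>2 - 2) - \<sigma>)" for w u z \<alpha> \<sigma> \<mu> \<rho>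
  proof -
    let ?V = "lyapunov_at f A b lam \<rho> \<mu> z"
    let ?L = "spectral_norm A"
    have \<sigma>: "\<sigma> > 0"
      using sc by (simp add: strongly_convex_def)
    have \<alpha>: "\<alpha> > 0" and stat: "gradient f w + transpose A *v z = 0"
      and prox: "u \<in> prox_l0_pos \<alpha> lam (u + \<alpha> *\<^sub>R z)" and feas: "A *v w + b - u = 0"
      using P by (auto simp: P_stationary_def)
    \<comment> \<open>The share of the growth that the proximal error can consume.\<close>
    define \<theta> where "\<theta> = (?L\<^sup>2 / \<sigma> + 1 / \<rho>) / \<alpha>"
    have \<theta>: "\<theta> < 1"
      using penalty_parameters_bound[OF \<sigma> par(2,3,1,4,5)] \<alpha> by (simp add: \<theta>_def)
    have growth: "?V (w', u', v') \<ge> ?V (w, u, w)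
        + (1 - \<theta>) / 2 * (\<sigma> * (norm (w' - w))\<^sup>2 + \<rho> * (norm (A *v (w' - w) - (u' - u)))\<^sup>2)
        + \<mu> / 2 * (norm (w' - v'))\<^sup>2" for w' u' v'
    proof -
      define s where "s = norm (w' - w)"
      define c where "c = norm (A *v (w' - w) - (u' - u))"
      have "f w' \<ge> f w + inner (gradient f w) (w' - w) + \<sigma> / 2 * (norm (w' - w))\<^sup>2"
        by (rule gradient_inequality[OF diff]) (use sc in \<open>simp add: strongly_convex_def\<close>)
      moreover have "lam * real (l0_norm (pos_part u)) + inner z (u' - u)
          \<le> lam * real (l0_norm (pos_part u')) + 1 / (2 * \<alpha>) * (norm (u' - u))\<^sup>2"
        using prox prox_l0_pos_iff[OF \<alpha>] by blast
      ultimately have "?V (w', u', v') \<ge> ?V (w, u, w) + \<sigma> / 2 * (norm (w' - w))\<^sup>2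
          - 1 / (2 * \<alpha>) * (norm (u' - u))\<^sup>2 + \<rho> / 2 * c\<^sup>2 + \<mu> / 2 * (norm (w' - v'))\<^sup>2"
        unfolding c_def by (rule lyapunov_at_lower_bound[OF feas stat])
      moreover have "1 / (2 * \<alpha>) * (norm (u' - u))\<^sup>2 \<le> \<theta> / 2 * (\<sigma> * s\<^sup>2 + \<rho> * c\<^sup>2)"
      proof -
        have "norm (u' - u) = norm (A *v (w' - w) - (A *v (w' - w) - (u' - u)))" by simp
        also have "\<dots> \<le> norm (A *v (w' - w)) + c"
          unfolding c_def by (rule norm_triangle_ineq4)
        also have "norm (A *v (w' - w)) \<le> ?L * s"
          unfolding spectral_norm_def s_def by (intro onorm matrix_vector_mul_bounded_linear)
        finally have "(norm (u' - u))\<^sup>2 \<le> (?L * s + c)\<^sup>2"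
          by (intro power_mono) simp_all
        also have "\<dots> \<le> (?L\<^sup>2 / \<sigma> + 1 / \<rho>) * (\<sigma> * s\<^sup>2 + \<rho> * c\<^sup>2)"
          by (rule weighted_square_bound[OF \<sigma> par(3)])
        finally have "1 / (2 * \<alpha>) * (norm (u' - u))\<^sup>2
            \<le> 1 / (2 * \<alpha>) * ((?L\<^sup>2 / \<sigma> + 1 / \<rho>) * (\<sigma> * s\<^sup>2 + \<rho> * c\<^sup>2))"
          using \<alpha> by (intro mult_left_mono) simp_all
        also have "\<dots> = \<theta> / 2 * (\<sigma> * s\<^sup>2 + \<rho> * c\<^sup>2)"
          by (simp add: \<theta>_def)
        finally show ?thesis .
      qed
      ultimately show ?thesis
        unfolding s_def[symmetric] c_def[symmetric] by (simp add: algebra_simps diff_divide_distrib)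
    qed
    have nonneg: "(1 - \<theta>) / 2 * (\<sigma> * (norm x)\<^sup>2 + \<rho> * (norm y)\<^sup>2) \<ge> 0" "\<mu> / 2 * (norm x)\<^sup>2 \<ge> 0"
      for x :: "real^'p" and y :: "real^'n"
      using \<theta> \<sigma> par(2,3) by simp_all
    have "?V (w, u, w) \<le> ?V y" for y
    proof (cases y)
      case (fields w' u' v')
      show ?thesis
        using growth[of w' u' v'] nonneg(1)[of "w' - w" "A *v (w' - w) - (u' - u)"]
          nonneg(2)[of "w' - v'"] unfolding fields by linarith
    qed
    moreover have "y = (w, u, w)" if "global_minimizer ?V y" for y
    proof (cases y)
      case (fields w' u' v')
      have "?V (w', u', v') \<le> ?V (w, u, w)"
        using that by (simp add: global_minimizer_def fields)
      then have "(1 - \<theta>) / 2 * (\<sigma> * (norm (w' - w))\<^sup>2 + \<rho> * (norm (A *v (w' - w) - (u' - u)))\<^sup>2) = 0"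
          and "\<mu> / 2 * (norm (w' - v'))\<^sup>2 = 0"
        using growth[of w' u' v'] nonneg(1)[of "w' - w" "A *v (w' - w) - (u' - u)"]
          nonneg(2)[of "w' - v'"] by linarith+
      then have "\<sigma> * (norm (w' - w))\<^sup>2 + \<rho> * (norm (A *v (w' - w) - (u' - u)))\<^sup>2 = 0" and v: "v' = w'"
        using \<theta> par(2) by simp_all
      moreover have "\<sigma> * (norm (w' - w))\<^sup>2 \<ge> 0" "\<rho> * (norm (A *v (w' - w) - (u' - u)))\<^sup>2 \<ge> 0"
        using \<sigma> par(3) by simp_all
      ultimately have "\<sigma> * (norm (w' - w))\<^sup>2 = 0" "\<rho> * (norm (A *v (w' - w) - (u' - u)))\<^sup>2 = 0"
        by linarith+
      then have "w' = w" and res: "A *v (w' - w) - (u' - u) = 0"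
        using \<sigma> par(3) by simp_all
      moreover from this have "u' = u"
        using res by simp
      ultimately show ?thesis
        by (simp add: fields v)
    qed
    ultimately show ?thesis
      by (simp add: unique_global_minimizer_def global_minimizer_def)
  qed
  show ?thesis
  proof (intro conjI allI impI, goal_cases)
    case 1
    show ?case by (rule i[OF 1(1)])
  next
    case 2
    then show ?case by (elim conjE) (rule ii)
  next
    case 3
    then show ?case by (elim conjE) (rule iii)
  qed
qed

end
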